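(* Let $\gamma:D\to\mathbb C^2$ be a regular holomorphic curve. Suppose that $t_0\in D$ is an isotropic point of $\gamma$ and that $\gamma$ has an ordinary contact with its tangent line at $t_0$. Then the evolute of $\gamma$ extends to a holomorphic curve at $t_0$ that is tangent to $\gamma$ at this point.
   Context: $D\subset\mathbb C$ is a connected and simply connected open set, $\gamma=(z_1,z_2)$ is holomorphic with $\gamma'(t)\ne0$ for all $t$. $\mathbb C^2$ carries the complex bilinear form $\langle v,w\rangle=v_1w_1+v_2w_2$. A non-zero vector $v$ is isotropic if $\langle v,v\rangle=0$; $t_0$ (or $\gamma(t_0)$) is an isotropic point of $\gamma$ if $\gamma'(t_0)$ is isotropic. Ordinary contact with the tangent line at $t_0$ means the contact has order exactly two, equivalently $(z_1'z_2''-z_2'z_1'')(t_0)\ne0$. At points $t$ that are neither isotropic points nor inflections (i.e. $\langle\gamma'(t),\gamma'(t)\rangle\ne0$ and $(z_1'z_2''-z_2'z_1'')(t)\neq0$), the evolute of $\gamma$ is the curve $$e(t)=(z_1(t),z_2(t))+\frac{(z_1'^2+z_2'^2)(t)}{(z_1'z_2''-z_2'z_1'')(t)}\,(-z_2'(t),z_1'(t)).$$ Tangent to $\gamma$ at this point means that the extended curve passes through $\gamma(t_0)$ at $t_0$ and has there the same tangent line as $\gamma$. *)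

theory Defs
  imports "HOL-Complex_Analysis.Complex_Analysis"
begin

text \<open>
  The complex bilinear form \<open>\<langle>v, w\<rangle> = v\<^sub>1 w\<^sub>1 + v\<^sub>2 w\<^sub>2\<close> on \<open>\<complex>\<^sup>2\<close> is the library's
  \<open>scalar_product\<close>; the inner product of the type \<open>complex ^ 2\<close> is the real one and is not
  used. Likewise all derivatives are complex derivatives, taken componentwise.
\<close>

definition holomorphic_curve :: "(complex \<Rightarrow> complex ^ 2) \<Rightarrow> complex set \<Rightarrow> bool" where
  "holomorphic_curve \<gamma> D \<longleftrightarrow> (\<forall>i. (\<lambda>t. \<gamma> t $ i) holomorphic_on D)"

definition velocity :: "(complex \<Rightarrow> complex ^ 2) \<Rightarrow> complex \<Rightarrow> complex ^ 2" where
  "velocity \<gamma> t = (\<chi> i. deriv (\<lambda>s. \<gamma> s $ i) t)"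

definition regular_curve :: "(complex \<Rightarrow> complex ^ 2) \<Rightarrow> complex set \<Rightarrow> bool" where
  "regular_curve \<gamma> D \<longleftrightarrow> holomorphic_curve \<gamma> D \<and> (\<forall>t\<in>D. velocity \<gamma> t \<noteq> 0)"

definition isotropic :: "complex ^ 2 \<Rightarrow> bool" where
  "isotropic v \<longleftrightarrow> v \<noteq> 0 \<and> scalar_product v v = 0"

definition isotropic_point :: "(complex \<Rightarrow> complex ^ 2) \<Rightarrow> complex \<Rightarrow> bool" where
  "isotropic_point \<gamma> t \<longleftrightarrow> isotropic (velocity \<gamma> t)"

definition det2 :: "complex ^ 2 \<Rightarrow> complex ^ 2 \<Rightarrow> complex" where
  "det2 v w = v $ 1 * w $ 2 - v $ 2 * w $ 1"

definition tangent_line :: "(complex \<Rightarrow> complex ^ 2) \<Rightarrow> complex \<Rightarrow> (complex ^ 2) set" where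
  "tangent_line \<gamma> t = range (\<lambda>c. \<gamma> t + c *s velocity \<gamma> t)"

text \<open>
  At a regular point \<open>t\<^sub>0\<close> the tangent line has the equation
  \<open>det2 (velocity \<gamma> t\<^sub>0) (p - \<gamma> t\<^sub>0) = 0\<close> in \<open>p\<close>. The order of contact is the exact order of
  vanishing at \<open>t\<^sub>0\<close> of this equation along the curve.
\<close>

definition tangent_contact_order ::
  "(complex \<Rightarrow> complex ^ 2) \<Rightarrow> complex \<Rightarrow> nat \<Rightarrow> bool" where
  "tangent_contact_order \<gamma> t0 k \<longleftrightarrow>
     (let f = (\<lambda>t. det2 (velocity \<gamma> t0) (\<gamma> t - \<gamma> t0))
      in (\<forall>j<k. (deriv ^^ j) f t0 = 0) \<and> (deriv ^^ k) f t0 \<noteq> 0)"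

definition ordinary_contact :: "(complex \<Rightarrow> complex ^ 2) \<Rightarrow> complex \<Rightarrow> bool" where
  "ordinary_contact \<gamma> t0 \<longleftrightarrow> tangent_contact_order \<gamma> t0 2"

text \<open>The determinant \<open>z\<^sub>1' z\<^sub>2'' - z\<^sub>2' z\<^sub>1''\<close>, whose zeros are the inflections.\<close>

definition inflection_det :: "(complex \<Rightarrow> complex ^ 2) \<Rightarrow> complex \<Rightarrow> complex" where
  "inflection_det \<gamma> t = det2 (velocity \<gamma> t) (velocity (velocity \<gamma>) t)"

definition evolute_domain ::
  "(complex \<Rightarrow> complex ^ 2) \<Rightarrow> complex set \<Rightarrow> complex set" where
  "evolute_domain \<gamma> D =
     {t \<in> D. scalar_product (velocity \<gamma> t) (velocity \<gamma> t) \<noteq> 0 \<and> inflection_det \<gamma> t \<noteq> 0}"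

text \<open>Only meaningful on \<^term>\<open>evolute_domain \<gamma> D\<close>.\<close>

definition evolute :: "(complex \<Rightarrow> complex ^ 2) \<Rightarrow> complex \<Rightarrow> complex ^ 2" where
  "evolute \<gamma> t = \<gamma> t +
     (scalar_product (velocity \<gamma> t) (velocity \<gamma> t) / inflection_det \<gamma> t) *s
       vector [- (velocity \<gamma> t $ 2), velocity \<gamma> t $ 1]"

text \<open>
  If \<open>\<gamma>\<close> is regular at \<open>t\<close>, equality of the tangent lines forces \<open>\<eta>\<close> to be regular at \<open>t\<close>
  as well.
\<close>

definition tangent_at ::
  "(complex \<Rightarrow> complex ^ 2) \<Rightarrow> (complex \<Rightarrow> complex ^ 2) \<Rightarrow> complex \<Rightarrow> bool" where
  "tangent_at \<eta> \<gamma> t \<longleftrightarrow> \<eta> t = \<gamma> t \<and> tangent_line \<eta> t = tangent_line \<gamma> t"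

lemma ordinary_contact_iff_inflection_det:
  assumes "open D" "holomorphic_curve \<gamma> D" "t0 \<in> D"
  shows "ordinary_contact \<gamma> t0 \<longleftrightarrow> inflection_det \<gamma> t0 \<noteq> 0"
proof -
  define a where "a = velocity \<gamma> t0"
  define f where "f = (\<lambda>t. det2 a (\<gamma> t - \<gamma> t0))"
  have h: "(\<lambda>t. \<gamma> t $ i) holomorphic_on D" for i
    using assms(2) by (simp add: holomorphic_curve_def)
  have d: "((\<lambda>t. \<gamma> t $ i) has_field_derivative velocity \<gamma> t $ i) (at t)" if "t \<in> D" for t i
    using holomorphic_derivI[OF h assms(1) that] by (simp add: velocity_def)
  have hd: "(\<lambda>t. velocity \<gamma> t $ i) holomorphic_on D" for i
    using holomorphic_deriv[OF h assms(1)] by (simp add: velocity_def)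
  have dd: "((\<lambda>t. velocity \<gamma> t $ i) has_field_derivative velocity (velocity \<gamma>) t0 $ i) (at t0)"
    for i
    using holomorphic_derivI[OF hd assms(1,3)] by (simp add: velocity_def)
  have f1: "(f has_field_derivative det2 a (velocity \<gamma> t)) (at t)" if "t \<in> D" for t
    unfolding f_def det2_def by (auto intro!: derivative_eq_intros d that)
  have ev: "eventually (\<lambda>t. deriv f t = det2 a (velocity \<gamma> t)) (nhds t0)"
    using eventually_nhds_in_open[OF assms(1,3)]
    by eventually_elim (use f1 DERIV_imp_deriv in blast)
  have "((\<lambda>t. det2 a (velocity \<gamma> t)) has_field_derivative inflection_det \<gamma> t0) (at t0)"
    unfolding det2_def inflection_det_def a_def by (auto intro!: derivative_eq_intros dd)
  then have "deriv (deriv f) t0 = inflection_det \<gamma> t0"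
    using deriv_cong_ev[OF ev refl] DERIV_imp_deriv by metis
  moreover have "f t0 = 0" by (simp add: f_def det2_def)
  moreover have "deriv f t0 = 0"
    using DERIV_imp_deriv[OF f1[OF assms(3)]] by (simp add: det2_def a_def)
  ultimately show ?thesis
    unfolding ordinary_contact_def tangent_contact_order_def a_def[symmetric] f_def[symmetric] Let_def
    by (auto simp: numeral_2_eq_2 less_Suc_eq)
qed

end

theory Submission
  imports Defs
begin

text \<open>
  Write \<open>v = \<gamma>'\<close>, \<open>w = \<gamma>''\<close>, \<open>J (a, b) = (- b, a)\<close>, so that the evolute is
  \<open>\<gamma> + (\<langle>v, v\<rangle> / det2 v w) J v\<close>. The only denominator is the inflection determinant, which
  ordinary contact makes non-zero at \<open>t\<^sub>0\<close>. Hence the defining formula itself is the extension: it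
  is holomorphic near \<open>t\<^sub>0\<close>, and as \<open>\<langle>v, v\<rangle>\<close> vanishes at \<open>t\<^sub>0\<close>, it passes through \<open>\<gamma> t\<^sub>0\<close>.

  The tangency rests on one algebraic fact: an isotropic \<open>v\<close> is an eigenvector of the quarter turn
  \<open>J\<close>, and more precisely \<open>\<langle>v, w\<rangle> J v = det2 v w \<cdot> v\<close> for every \<open>w\<close>
  (\<open>isotropic_quarter_turn\<close>). Since \<open>\<langle>v, v\<rangle>' = 2 \<langle>v, w\<rangle>\<close>, differentiating the evolute at \<open>t\<^sub>0\<close>,
  where the terms with the factor \<open>\<langle>v, v\<rangle>\<close> disappear, gives
  \<open>e' = v + (2 \<langle>v, w\<rangle> / det2 v w) J v = 3 v\<close>, a non-zero multiple of the velocity of \<open>\<gamma>\<close>.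

  The same fact shows that \<open>\<langle>v, w\<rangle> \<noteq> 0\<close> at \<open>t\<^sub>0\<close>, so \<open>\<langle>v, v\<rangle>\<close> has a simple, hence isolated, zero
  there. This is why adding \<open>t\<^sub>0\<close> to the domain of the evolute yields an open set.
\<close>

lemma scalar_product_2:
  "scalar_product v w = v $ 1 * w $ 1 + v $ 2 * w $ 2" for v w :: "complex ^ 2"
  by (simp add: scalar_product_def sum_2)

text \<open>
  The square of \<open>J\<close> is \<open>- 1\<close>, and its eigenlines, for the eigenvalues \<open>\<plusminus> \<i>\<close>, are exactly the two
  isotropic lines. Stating the relation with an auxiliary \<open>w\<close> avoids having to distinguish them.
\<close>

lemma isotropic_quarter_turn:
  assumes "scalar_product v v = 0"
  shows "scalar_product v w *s vector [- (v $ 2), v $ 1] = det2 v w *s v"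
proof -
  have "v $ 1 * v $ 1 + v $ 2 * v $ 2 = 0"
    using assms by (simp add: scalar_product_2)
  then have
    "(v $ 1 * w $ 1 + v $ 2 * w $ 2) * (- (v $ 2)) = (v $ 1 * w $ 2 - v $ 2 * w $ 1) * v $ 1"
    "(v $ 1 * w $ 1 + v $ 2 * w $ 2) * v $ 1 = (v $ 1 * w $ 2 - v $ 2 * w $ 1) * v $ 2"
    by algebra+
  then show ?thesis
    by (simp add: vec_eq_iff forall_2 vector_2 scalar_product_2 det2_def algebra_simps)
qed

lemma isotropic_scalar_product_nonzero:
  assumes "isotropic v" "det2 v w \<noteq> 0"
  shows "scalar_product v w \<noteq> 0"
proof
  assume "scalar_product v w = 0"
  then have "det2 v w *s v = 0"
    using isotropic_quarter_turn[of v w] assms(1) by (simp add: isotropic_def)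
  then show False
    using assms by (simp add: isotropic_def)
qed

lemma holomorphic_curve_velocity:
  assumes "open D" "holomorphic_curve \<gamma> D"
  shows "holomorphic_curve (velocity \<gamma>) D"
  using assms holomorphic_deriv by (auto simp: holomorphic_curve_def velocity_def)

lemma holomorphic_curve_has_velocity:
  assumes "open D" "holomorphic_curve \<gamma> D" "t \<in> D"
  shows "((\<lambda>s. \<gamma> s $ i) has_field_derivative velocity \<gamma> t $ i) (at t)"
  using assms by (auto simp: holomorphic_curve_def velocity_def intro: holomorphic_derivI)

lemma scalar_product_velocity_has_derivative:
  assumes "open D" "holomorphic_curve \<gamma> D" "t \<in> D"
  shows "((\<lambda>s. scalar_product (velocity \<gamma> s) (velocity \<gamma> s)) has_field_derivative
           2 * scalar_product (velocity \<gamma> t) (velocity (velocity \<gamma>) t)) (at t)"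
  unfolding scalar_product_2
  by (auto intro!: derivative_eq_intros
        holomorphic_curve_has_velocity[OF assms(1) holomorphic_curve_velocity[OF assms(1,2)] assms(3)]
      simp: algebra_simps)

lemma holomorphic_on_scalar_product_velocity:
  assumes "open D" "holomorphic_curve \<gamma> D"
  shows "(\<lambda>t. scalar_product (velocity \<gamma> t) (velocity \<gamma> t)) holomorphic_on D"
  using holomorphic_curve_velocity[OF assms]
  by (auto simp: scalar_product_2 holomorphic_curve_def intro!: holomorphic_intros)

lemma holomorphic_on_inflection_det:
  assumes "open D" "holomorphic_curve \<gamma> D"
  shows "inflection_det \<gamma> holomorphic_on D"
  using holomorphic_curve_velocity[OF assms]
    holomorphic_curve_velocity[OF assms(1) holomorphic_curve_velocity[OF assms]]
  unfolding inflection_det_def[abs_def] det2_def holomorphic_curve_def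
  by (intro holomorphic_intros) auto

text \<open>
  The only denominator in the formula of the evolute is the inflection determinant, so \<open>S\<close> may
  contain isotropic points; the values there are those of the holomorphic extension.
\<close>

lemma holomorphic_curve_evolute:
  assumes "open D" "holomorphic_curve \<gamma> D"
    and "S \<subseteq> D" "\<And>t. t \<in> S \<Longrightarrow> inflection_det \<gamma> t \<noteq> 0"
  shows "holomorphic_curve (evolute \<gamma>) S"
proof -
  have hol: "(\<lambda>t. \<gamma> t $ i) holomorphic_on S" "(\<lambda>t. velocity \<gamma> t $ i) holomorphic_on S"
    "(\<lambda>t. scalar_product (velocity \<gamma> t) (velocity \<gamma> t)) holomorphic_on S"
    "inflection_det \<gamma> holomorphic_on S" for i
    using assms(2) holomorphic_curve_velocity[OF assms(1,2)]
      holomorphic_on_scalar_product_velocity[OF assms(1,2)]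
      holomorphic_on_inflection_det[OF assms(1,2)]
    by (auto simp: holomorphic_curve_def intro: holomorphic_on_subset[OF _ assms(3)])
  have "(\<lambda>t. evolute \<gamma> t $ i) holomorphic_on S" if "i = 1 \<or> i = 2" for i
    using that assms(4)
    by (auto simp: evolute_def vector_2 intro!: holomorphic_intros hol)
  then show ?thesis
    using exhaust_2 by (auto simp: holomorphic_curve_def)
qed

lemma open_evolute_domain:
  assumes "open D" "holomorphic_curve \<gamma> D"
  shows "open (evolute_domain \<gamma> D)"
proof -
  let ?h = "\<lambda>t. scalar_product (velocity \<gamma> t) (velocity \<gamma> t) * inflection_det \<gamma> t"
  have "continuous_on D ?h"
    using holomorphic_on_scalar_product_velocity[OF assms] holomorphic_on_inflection_det[OF assms]
    by (intro holomorphic_on_imp_continuous_on holomorphic_intros)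
  then have "open (?h -` (- {0}) \<inter> D)"
    using assms(1) continuous_on_open_vimage by blast
  moreover have "evolute_domain \<gamma> D = ?h -` (- {0}) \<inter> D"
    by (auto simp: evolute_domain_def)
  ultimately show ?thesis
    by simp
qed

lemma open_insert_evolute_domain:
  assumes "open D" "holomorphic_curve \<gamma> D" "t \<in> D"
    and "isotropic_point \<gamma> t" "inflection_det \<gamma> t \<noteq> 0"
  shows "open (insert t (evolute_domain \<gamma> D))"
proof -
  let ?g = "\<lambda>s. scalar_product (velocity \<gamma> s) (velocity \<gamma> s)"
  have zero: "?g t = 0"
    using assms(4) by (simp add: isotropic_point_def isotropic_def)
  have deriv: "2 * scalar_product (velocity \<gamma> t) (velocity (velocity \<gamma>) t) \<noteq> 0"
    using isotropic_scalar_product_nonzero assms(4,5)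
    by (simp add: isotropic_point_def inflection_det_def)
  \<comment> \<open>the difference quotient of \<open>?g\<close> tends to the non-zero derivative, so \<open>t\<close> is an isolated zero\<close>
  have "((\<lambda>s. (?g s - ?g t) / (s - t)) \<longlongrightarrow>
          2 * scalar_product (velocity \<gamma> t) (velocity (velocity \<gamma>) t)) (at t)"
    using scalar_product_velocity_has_derivative[OF assms(1,2,3)]
    by (simp add: has_field_derivative_iff)
  then have "\<forall>\<^sub>F s in at t. (?g s - ?g t) / (s - t) \<noteq> 0"
    using deriv by (rule tendsto_imp_eventually_ne)
  moreover have "\<forall>\<^sub>F s in at t. s \<in> D"
    using assms(1,3) by (rule eventually_at_in_open')
  moreover have "\<forall>\<^sub>F s in at t. inflection_det \<gamma> s \<noteq> 0"
  proof (rule tendsto_imp_eventually_ne[OF _ assms(5)])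
    show "(inflection_det \<gamma> \<longlongrightarrow> inflection_det \<gamma> t) (at t)"
      using holomorphic_on_imp_continuous_on[OF holomorphic_on_inflection_det[OF assms(1,2)]]
        assms(1,3) by (simp add: continuous_on_eq_continuous_at isCont_def)
  qed
  ultimately have "\<forall>\<^sub>F s in at t. s \<in> evolute_domain \<gamma> D"
    by eventually_elim (auto simp: evolute_domain_def zero)
  then obtain U where "open U" "t \<in> U" "\<And>s. s \<in> U \<Longrightarrow> s \<noteq> t \<Longrightarrow> s \<in> evolute_domain \<gamma> D"
    by (auto simp: eventually_at_topological)
  then have "insert t (evolute_domain \<gamma> D) = U \<union> evolute_domain \<gamma> D"
    by auto
  then show ?thesis
    using \<open>open U\<close> open_evolute_domain[OF assms(1,2)] by (simp add: open_Un)
qed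

text \<open>
  With \<open>v = \<gamma>'\<close> and \<open>w = \<gamma>''\<close> at \<open>t\<close>, the factor \<open>3\<close> is \<open>1 + 2\<close>: the first summand comes from
  \<open>\<gamma>\<close>, the second from \<open>\<langle>v, v\<rangle>' = 2 \<langle>v, w\<rangle>\<close> and \<open>isotropic_quarter_turn\<close>.
\<close>

lemma velocity_evolute_isotropic:
  assumes "open D" "holomorphic_curve \<gamma> D" "t \<in> D"
    and "isotropic_point \<gamma> t" "inflection_det \<gamma> t \<noteq> 0"
  shows "velocity (evolute \<gamma>) t = 3 *s velocity \<gamma> t"
proof -
  let ?v = "velocity \<gamma> t" and ?w = "velocity (velocity \<gamma>) t"
  let ?g = "\<lambda>s. scalar_product (velocity \<gamma> s) (velocity \<gamma> s)"
  let ?J = "\<lambda>s. vector [- (velocity \<gamma> s $ 2), velocity \<gamma> s $ 1] :: complex ^ 2"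
  have zero: "?g t = 0"
    using assms(4) by (simp add: isotropic_point_def isotropic_def)
  have dJ: "((\<lambda>s. ?J s $ i) has_field_derivative (vector [- (?w $ 2), ?w $ 1] :: complex ^ 2) $ i) (at t)"
    for i
    using exhaust_2[of i]
    by (auto simp: vector_2 intro!: DERIV_minus
        holomorphic_curve_has_velocity[OF assms(1) holomorphic_curve_velocity[OF assms(1,2)] assms(3)])
  have dd: "(inflection_det \<gamma> has_field_derivative deriv (inflection_det \<gamma>) t) (at t)"
    using holomorphic_derivI[OF holomorphic_on_inflection_det[OF assms(1,2)] assms(1,3)] .
  have "velocity (evolute \<gamma>) t $ i = 3 * ?v $ i" for i
  proof -
    have "((\<lambda>s. evolute \<gamma> s $ i) has_field_derivative
            ?v $ i + 2 * scalar_product ?v ?w / inflection_det \<gamma> t * ?J t $ i) (at t)"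
      using zero assms(5) unfolding evolute_def
      by (auto intro!: derivative_eq_intros dd dJ
          holomorphic_curve_has_velocity[OF assms(1,2,3)]
          scalar_product_velocity_has_derivative[OF assms(1,2,3)])
    moreover have "scalar_product ?v ?w * ?J t $ i = inflection_det \<gamma> t * ?v $ i"
      using arg_cong[OF isotropic_quarter_turn[OF zero, of ?w], of "\<lambda>x. x $ i"]
      by (simp add: inflection_det_def)
    then have "?v $ i + 2 * scalar_product ?v ?w / inflection_det \<gamma> t * ?J t $ i = 3 * ?v $ i"
      using assms(5) by (simp add: field_simps)
    ultimately show ?thesis
      by (simp add: velocity_def DERIV_imp_deriv)
  qed
  then show ?thesis
    by (simp add: vec_eq_iff)
qed

lemma tangent_at_scaled_velocity:
  assumes "\<eta> t = \<gamma> t" "velocity \<eta> t = c *s velocity \<gamma> t" "c \<noteq> 0"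
  shows "tangent_at \<eta> \<gamma> t"
proof -
  have "range (\<lambda>k. \<gamma> t + k *s (c *s velocity \<gamma> t)) = (\<lambda>k. \<gamma> t + k *s velocity \<gamma> t) ` range (\<lambda>k. k * c)"
    by (simp add: image_image vector_smult_assoc)
  also have "range (\<lambda>k. k * c) = UNIV"
    using assms(3) by (intro surjI[of _ "\<lambda>k. k / c"]) simp
  finally show ?thesis
    using assms(1,2) by (simp add: tangent_at_def tangent_line_def)
qed

theorem proposition3p14:
  fixes D :: "complex set" and \<gamma> :: "complex \<Rightarrow> complex ^ 2" and t0 :: complex
  assumes "open D" and "connected D" and "simply_connected D"
    and "regular_curve \<gamma> D"
    and "t0 \<in> D"
    and "isotropic_point \<gamma> t0"
    and "ordinary_contact \<gamma> t0"
  shows "open (insert t0 (evolute_domain \<gamma> D)) \<and>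
    (\<exists>E. holomorphic_curve E (insert t0 (evolute_domain \<gamma> D)) \<and>
         (\<forall>t\<in>evolute_domain \<gamma> D. E t = evolute \<gamma> t) \<and>
         tangent_at E \<gamma> t0)"
proof -
  have hol: "holomorphic_curve \<gamma> D"
    using assms(4) by (simp add: regular_curve_def)
  have infl: "inflection_det \<gamma> t0 \<noteq> 0"
    using ordinary_contact_iff_inflection_det[OF assms(1) hol assms(5)] assms(7) by simp
  have "holomorphic_curve (evolute \<gamma>) (insert t0 (evolute_domain \<gamma> D))"
    using assms(5) infl
    by (intro holomorphic_curve_evolute[OF assms(1) hol]) (auto simp: evolute_domain_def)
  moreover have "evolute \<gamma> t0 = \<gamma> t0"
    using assms(6) by (simp add: evolute_def isotropic_point_def isotropic_def)
  then have "tangent_at (evolute \<gamma>) \<gamma> t0"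
    using velocity_evolute_isotropic[OF assms(1) hol assms(5,6) infl]
    by (rule tangent_at_scaled_velocity) simp
  ultimately show ?thesis
    using open_insert_evolute_domain[OF assms(1) hol assms(5,6) infl] by blast
qed

end
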